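(* Let $N=r_1+r_2$ with natural numbers $r_1,r_2$, and let $w\in\mathcal{H}^{(r_1,r_2)}$ be a fixed vector, written in the form $w = a_w\cdot 1_{\mathcal{S}_{r_1,r_2}}|\tau_0\rangle$ with $a_w\in\mathcal{L}_{\mathbb{C}}\mathfrak{R}_{r_1,r_2}$ and $|\tau_0\rangle := |1,\ldots,1,2,\ldots,2\rangle$ ($r_1$ ones followed by $r_2$ twos). Consider the right ideal $\mathcal{R}_w := a_w\cdot 1_{\mathcal{S}_{r_1,r_2}}\cdot\mathbb{C}[\mathcal{S}_N]$ of $\mathbb{C}[\mathcal{S}_N]$. (i) $w\in\mathcal{H}_{\mathcal{R}_w}$. (ii) Every right ideal $\mathcal{R}\subseteq\mathbb{C}[\mathcal{S}_N]$ whose symmetry class $\mathcal{H}_{\mathcal{R}}$ contains $w$ satisfies $\mathcal{R}_w\subseteq\mathcal{R}$.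
   Context: $\mathcal{H}$ is the complex vector space with basis the symbols $|\sigma\rangle=|\sigma(1),\ldots,\sigma(N)\rangle$, $\sigma$ running over all functions $\{1,\ldots,N\}\to\{1,2\}$. For natural numbers $r_1,r_2$ (zero allowed) with $r_1+r_2=N$, $\mathcal{H}^{(r_1,r_2)}$ is the complex span of all $|\sigma\rangle$ with $|\sigma^{-1}(1)|=r_1$ and $|\sigma^{-1}(2)|=r_2$. $\mathcal{S}_N$ is the symmetric group on $\{1,\ldots,N\}$ with product $(p\circ q)(i)=p(q(i))$, and $\mathbb{C}[\mathcal{S}_N]$ is its complex group ring. It acts on $\mathcal{H}$ by linear extension of $p|\sigma\rangle := |\sigma\circ p^{-1}\rangle$. $\mathcal{S}_{r_1,r_2}\cong\mathcal{S}_{r_1}\times\mathcal{S}_{r_2}$ is the Young subgroup of all permutations that permute $\{1,\ldots,r_1\}$ and $\{r_1+1,\ldots,N\}$ each within itself, and $1_{\mathcal{S}_{r_1,r_2}} := \frac{1}{r_1!\,r_2!}\sum_{s\in\mathcal{S}_{r_1,r_2}}s$. $\mathfrak{R}_{r_1,r_2}$ is the set of the lexicographically smallest elements (permutations written as lists $(p(1),\ldots,p(N))$) of the left cosets $p\cdot\mathcal{S}_{r_1,r_2}$, and $\mathcal{L}_{\mathbb{C}}$ denotes complex linear span; every $w\in\mathcal{H}^{(r_1,r_2)}$ can be written as $a_w\cdot 1_{\mathcal{S}_{r_1,r_2}}|\tau_0\rangle$ with a unique $a_w\in\mathcal{L}_{\mathbb{C}}\mathfrak{R}_{r_1,r_2}$.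 For a right ideal $\mathcal{R}\subseteq\mathbb{C}[\mathcal{S}_N]$, the symmetry class of $\mathcal{H}$ defined by $\mathcal{R}$ is $\mathcal{H}_{\mathcal{R}} := \{au\in\mathcal{H}\mid a\in\mathcal{R},\,u\in\mathcal{H}\}$. *)

theory Defs
  imports
    Complex_Main
    "HOL-Library.Poly_Mapping"
    "HOL-Library.FuncSet"
    "HOL-Algebra.Left_Coset"
    "HOL-Algebra.Sym_Groups"
    "HOL-Algebra.AbelCoset"
begin

section \<open>Formal complex linear combinations\<close>

definition cscale :: "complex \<Rightarrow> ('a \<Rightarrow>\<^sub>0 complex) \<Rightarrow> ('a \<Rightarrow>\<^sub>0 complex)" (infixr \<open>*\<^sub>c\<close> 75)
  where "c *\<^sub>c f = Poly_Mapping.map ((*) c) f"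

definition ket :: "'a \<Rightarrow> ('a \<Rightarrow>\<^sub>0 complex)"
  where "ket x = Poly_Mapping.single x 1"

lemma lookup_cscale [simp]:
  "Poly_Mapping.lookup (c *\<^sub>c f) x = c * Poly_Mapping.lookup f x"
  unfolding cscale_def by (transfer; simp add: when_def)

global_interpretation cvs: vector_space cscale
  by unfold_locales (auto intro!: poly_mapping_eqI simp: lookup_add algebra_simps)

text \<open>Linear extension to all formal combinations of a map given on the basis vectors.\<close>

definition lin_ext :: "('a \<Rightarrow> ('b \<Rightarrow>\<^sub>0 complex)) \<Rightarrow> ('a \<Rightarrow>\<^sub>0 complex) \<Rightarrow> ('b \<Rightarrow>\<^sub>0 complex)"
  where "lin_ext f a = (\<Sum>x\<in>Poly_Mapping.keys a. Poly_Mapping.lookup a x *\<^sub>c f x)"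

lemma lin_ext_superset:
  assumes "finite A" "Poly_Mapping.keys a \<subseteq> A"
  shows "lin_ext f a = (\<Sum>x\<in>A. Poly_Mapping.lookup a x *\<^sub>c f x)"
  unfolding lin_ext_def
  by (rule sum.mono_neutral_left) (use assms in \<open>auto simp: in_keys_iff\<close>)

lemma lin_ext_zero [simp]: "lin_ext f 0 = 0"
  by (simp add: lin_ext_def)

lemma lin_ext_add: "lin_ext f (a + b) = lin_ext f a + lin_ext f b"
proof -
  let ?A = "Poly_Mapping.keys a \<union> Poly_Mapping.keys b"
  have "lin_ext f c = (\<Sum>x\<in>?A. Poly_Mapping.lookup c x *\<^sub>c f x)" if "c \<in> {a, b, a + b}" for c
    by (rule lin_ext_superset) (use that keys_add[of a b] in auto)
  then show ?thesis
    by (simp add: lookup_add cvs.scale_left_distrib sum.distrib)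
qed

lemma lin_ext_cscale: "lin_ext f (c *\<^sub>c a) = c *\<^sub>c lin_ext f a"
proof -
  have "lin_ext f (c *\<^sub>c a)
      = (\<Sum>x\<in>Poly_Mapping.keys a. Poly_Mapping.lookup (c *\<^sub>c a) x *\<^sub>c f x)"
    by (rule lin_ext_superset) (auto simp: in_keys_iff)
  then show ?thesis
    by (simp add: lin_ext_def cvs.scale_sum_right)
qed

lemma lin_ext_ket [simp]: "lin_ext f (ket x) = f x"
  by (simp add: lin_ext_def ket_def)

lemma lin_ext_fun_add: "lin_ext (\<lambda>x. f x + g x) a = lin_ext f a + lin_ext g a"
  by (simp add: lin_ext_def cvs.scale_right_distrib sum.distrib)

lemma lin_ext_fun_cscale: "lin_ext (\<lambda>x. c *\<^sub>c f x) a = c *\<^sub>c lin_ext f a"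
  by (simp add: lin_ext_def cvs.scale_sum_right mult.commute)

lemma lin_ext_fun_zero [simp]: "lin_ext (\<lambda>x. 0) a = 0"
  by (simp add: lin_ext_def)


section \<open>The complex group ring and right ideals\<close>

definition group_ring :: "('g, 'm) monoid_scheme \<Rightarrow> ('g \<Rightarrow>\<^sub>0 complex) ring"
  where "group_ring G =
    \<lparr> carrier = cvs.span (ket ` carrier G),
      monoid.mult = (\<lambda>a b. lin_ext (\<lambda>p. lin_ext (\<lambda>q. ket (p \<otimes>\<^bsub>G\<^esub> q)) b) a),
      one = ket \<one>\<^bsub>G\<^esub>,
      zero = 0,
      add = (+) \<rparr>"

lemma group_ring_simps [simp]:
  "carrier (group_ring G) = cvs.span (ket ` carrier G)"
  "\<one>\<^bsub>group_ring G\<^esub> = ket \<one>\<^bsub>G\<^esub>"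
  "\<zero>\<^bsub>group_ring G\<^esub> = 0"
  "a \<oplus>\<^bsub>group_ring G\<^esub> b = a + b"
  by (simp_all add: group_ring_def)

lemma group_ring_mult_ket [simp]:
  "ket p \<otimes>\<^bsub>group_ring G\<^esub> ket q = ket (p \<otimes>\<^bsub>G\<^esub> q)"
  by (simp add: group_ring_def)

lemma group_ring_mult_linear:
  "(a + b) \<otimes>\<^bsub>group_ring G\<^esub> c = a \<otimes>\<^bsub>group_ring G\<^esub> c + b \<otimes>\<^bsub>group_ring G\<^esub> c"
  "a \<otimes>\<^bsub>group_ring G\<^esub> (b + c) = a \<otimes>\<^bsub>group_ring G\<^esub> b + a \<otimes>\<^bsub>group_ring G\<^esub> c"
  "(k *\<^sub>c a) \<otimes>\<^bsub>group_ring G\<^esub> b = k *\<^sub>c (a \<otimes>\<^bsub>group_ring G\<^esub> b)"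
  "a \<otimes>\<^bsub>group_ring G\<^esub> (k *\<^sub>c b) = k *\<^sub>c (a \<otimes>\<^bsub>group_ring G\<^esub> b)"
  "0 \<otimes>\<^bsub>group_ring G\<^esub> b = 0"
  "a \<otimes>\<^bsub>group_ring G\<^esub> 0 = 0"
  by (simp_all add: group_ring_def lin_ext_add lin_ext_cscale lin_ext_fun_add lin_ext_fun_cscale)

lemma ket_span_induct [consumes 1, case_names zero step]:
  assumes "a \<in> cvs.span (ket ` X)" "P 0"
    "\<And>c x a. x \<in> X \<Longrightarrow> P a \<Longrightarrow> P (c *\<^sub>c ket x + a)"
  shows "P a"
  by (rule cvs.span_induct_alt[OF assms(1)]) (use assms in auto)

lemma ring_group_ring:
  assumes "monoid G"
  shows "ring (group_ring G)"
proof -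
  interpret monoid G by fact
  let ?S = "cvs.span (ket ` carrier G)"
  let ?R = "group_ring G"
  note lin = group_ring_mult_linear
  have base: "ket x \<in> ?S" if "x \<in> carrier G" for x
    using that by (simp add: cvs.span_base)
  have closed1: "ket x \<otimes>\<^bsub>?R\<^esub> b \<in> ?S" if "b \<in> ?S" "x \<in> carrier G" for x b
    using that by (induction rule: ket_span_induct)
      (auto simp: lin intro!: cvs.span_add cvs.span_scale base cvs.span_zero)
  have closed: "a \<otimes>\<^bsub>?R\<^esub> b \<in> ?S" if "a \<in> ?S" "b \<in> ?S" for a b
    using that by (induction rule: ket_span_induct)
      (auto simp: lin intro!: cvs.span_add cvs.span_scale closed1 cvs.span_zero)
  have assoc1: "ket x \<otimes>\<^bsub>?R\<^esub> ket y \<otimes>\<^bsub>?R\<^esub> c = ket x \<otimes>\<^bsub>?R\<^esub> (ket y \<otimes>\<^bsub>?R\<^esub> c)"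
    if "c \<in> ?S" "x \<in> carrier G" "y \<in> carrier G" for x y c
    using that by (induction rule: ket_span_induct) (auto simp: lin m_assoc simp del: group_ring_mult_ket, auto simp: m_assoc)
  have assoc2: "ket x \<otimes>\<^bsub>?R\<^esub> b \<otimes>\<^bsub>?R\<^esub> c = ket x \<otimes>\<^bsub>?R\<^esub> (b \<otimes>\<^bsub>?R\<^esub> c)"
    if "b \<in> ?S" "x \<in> carrier G" "c \<in> ?S" for x b c
    using that by (induction rule: ket_span_induct) (auto simp: lin assoc1 simp del: group_ring_mult_ket)
  have assoc: "a \<otimes>\<^bsub>?R\<^esub> b \<otimes>\<^bsub>?R\<^esub> c = a \<otimes>\<^bsub>?R\<^esub> (b \<otimes>\<^bsub>?R\<^esub> c)"
    if "a \<in> ?S" "b \<in> ?S" "c \<in> ?S" for a b c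
    using that by (induction rule: ket_span_induct) (auto simp: lin assoc2)
  have one_l: "ket \<one>\<^bsub>G\<^esub> \<otimes>\<^bsub>?R\<^esub> a = a" and one_r: "a \<otimes>\<^bsub>?R\<^esub> ket \<one>\<^bsub>G\<^esub> = a" if "a \<in> ?S" for a
    using that by (induction rule: ket_span_induct) (auto simp: lin)
  show ?thesis
  proof (rule ringI)
    show "abelian_group ?R"
    proof (rule abelian_groupI)
      show "\<exists>y\<in>carrier ?R. y \<oplus>\<^bsub>?R\<^esub> x = \<zero>\<^bsub>?R\<^esub>" if "x \<in> carrier ?R" for x
        using that by (auto intro!: bexI[of _ "- x"] cvs.span_neg)
    qed (auto simp: algebra_simps intro!: cvs.span_add cvs.span_zero)
    show "monoid ?R"
      by (rule monoidI) (auto simp: closed assoc one_l one_r base)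
  qed (auto simp: lin)
qed

locale right_ideal = additive_subgroup I R + ring R for I and R (structure) +
  assumes I_r_closed: "\<lbrakk>a \<in> I; x \<in> carrier R\<rbrakk> \<Longrightarrow> a \<otimes> x \<in> I"

lemma (in ring) principal_right_ideal:
  assumes "a \<in> carrier R"
  shows "right_ideal (a <# carrier R) R"
proof (intro right_ideal.intro right_ideal_axioms.intro additive_subgroup.intro)
  show "subgroup (a <# carrier R) (add_monoid R)"
  proof (rule group.subgroupI[OF add.is_group])
    show "inv\<^bsub>add_monoid R\<^esub> x \<in> a <# carrier R" if "x \<in> a <# carrier R" for x
      using that assms by (auto simp: l_coset_def a_inv_def[symmetric] r_minus[symmetric])
    show "x \<otimes>\<^bsub>add_monoid R\<^esub> y \<in> a <# carrier R"
      if "x \<in> a <# carrier R" "y \<in> a <# carrier R" for x y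
      using that assms by (auto simp: l_coset_def r_distr[symmetric])
  qed (use assms in \<open>auto simp: l_coset_def\<close>)
  show "x \<otimes> y \<in> a <# carrier R" if "x \<in> a <# carrier R" "y \<in> carrier R" for x y
    using that assms by (auto simp: l_coset_def m_assoc)
qed (rule ring_axioms)


section \<open>The spin space and the action of the symmetric group\<close>

text \<open>A function \<open>{1..N} \<rightarrow> {1, 2}\<close> is represented by its extension by \<^const>\<open>undefined\<close>
  outside \<open>{1..N}\<close>.\<close>

definition spin_configs :: "nat \<Rightarrow> (nat \<Rightarrow> nat) set"
  where "spin_configs N = {1..N} \<rightarrow>\<^sub>E {1, 2}"

definition spin_space :: "nat \<Rightarrow> ((nat \<Rightarrow> nat) \<Rightarrow>\<^sub>0 complex) set"
  where "spin_space N = cvs.span (ket ` spin_configs N)"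

definition weight_space :: "nat \<Rightarrow> nat \<Rightarrow> ((nat \<Rightarrow> nat) \<Rightarrow>\<^sub>0 complex) set"
  where "weight_space r1 r2 = cvs.span (ket `
    {\<sigma> \<in> spin_configs (r1 + r2).
      card {i \<in> {1..r1 + r2}. \<sigma> i = 1} = r1 \<and> card {i \<in> {1..r1 + r2}. \<sigma> i = 2} = r2})"

abbreviation CS :: "nat \<Rightarrow> ((nat \<Rightarrow> nat) \<Rightarrow>\<^sub>0 complex) ring"
  where "CS N \<equiv> group_ring (sym_group N)"

definition act :: "((nat \<Rightarrow> nat) \<Rightarrow>\<^sub>0 complex) \<Rightarrow> ((nat \<Rightarrow> nat) \<Rightarrow>\<^sub>0 complex)
    \<Rightarrow> ((nat \<Rightarrow> nat) \<Rightarrow>\<^sub>0 complex)"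
  where "act a u = lin_ext (\<lambda>p. lin_ext (\<lambda>\<sigma>. ket (\<sigma> \<circ> Hilbert_Choice.inv p)) u) a"

definition young_subgroup :: "nat \<Rightarrow> nat \<Rightarrow> (nat \<Rightarrow> nat) set"
  where "young_subgroup r1 r2 = {s \<in> carrier (sym_group (r1 + r2)).
    s ` {1..r1} = {1..r1} \<and> s ` {r1 + 1..r1 + r2} = {r1 + 1..r1 + r2}}"

definition young_symmetrizer :: "nat \<Rightarrow> nat \<Rightarrow> ((nat \<Rightarrow> nat) \<Rightarrow>\<^sub>0 complex)"
  where "young_symmetrizer r1 r2 =
    (1 / (fact r1 * fact r2)) *\<^sub>c (\<Sum>s\<in>young_subgroup r1 r2. ket s)"

definition perm_list :: "nat \<Rightarrow> (nat \<Rightarrow> nat) \<Rightarrow> nat list"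
  where "perm_list N p = map p [1..<N + 1]"

definition lex_least_reps :: "nat \<Rightarrow> nat \<Rightarrow> (nat \<Rightarrow> nat) set"
  where "lex_least_reps r1 r2 =
    {p. \<exists>C \<in> lcosets\<^bsub>sym_group (r1 + r2)\<^esub> (young_subgroup r1 r2).
      p \<in> C \<and> (\<forall>q\<in>C. q \<noteq> p \<longrightarrow>
        (perm_list (r1 + r2) p, perm_list (r1 + r2) q) \<in> lexord less_than)}"

definition tau0 :: "nat \<Rightarrow> nat \<Rightarrow> (nat \<Rightarrow> nat)"
  where "tau0 r1 r2 = (\<lambda>i\<in>{1..r1 + r2}. if i \<le> r1 then 1 else 2)"

definition symmetry_class ::
  "nat \<Rightarrow> ((nat \<Rightarrow> nat) \<Rightarrow>\<^sub>0 complex) set \<Rightarrow> ((nat \<Rightarrow> nat) \<Rightarrow>\<^sub>0 complex) set"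
  where "symmetry_class N R = {act a u | a u. a \<in> R \<and> u \<in> spin_space N}"

end

theory Submission
  imports Defs
begin

text \<open>
  Write \<open>e\<close> for the Young symmetrizer and \<open>A = a\<^sub>w e\<close>, so that \<open>w = A|\<tau>\<^sub>0\<rangle>\<close>. The first claim
  holds because \<open>A = A \<cdot> 1\<close> is itself an element of \<open>A \<cdot> \<complex>[S\<^sub>N]\<close>.

  For the second claim it is enough to put \<open>A\<close> into every right ideal \<open>R\<close> with \<open>w = b u\<close>,
  \<open>b \<in> R\<close>. The idea is to undo the passage from group ring elements to vectors by one linear map
  \<open>\<Phi> : \<H> \<rightarrow> \<complex>[S\<^sub>N]\<close> that turns the action on \<open>\<H>\<close> into left multiplication. It sends a
  basis vector \<open>|\<sigma>\<rangle>\<close> to the sum of all permutations \<open>p\<close> with \<open>p|\<tau>\<^sub>0\<rangle> = |\<sigma>\<rangle>\<close>, divided by the order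
  of the stabilizer of \<open>|\<tau>\<^sub>0\<rangle>\<close> (this sum is empty, hence \<open>0\<close>, if \<open>\<sigma>\<close> does not lie in the orbit
  of \<open>\<tau>\<^sub>0\<close>). Left multiplication by \<open>q\<close> maps the permutations taking \<open>\<tau>\<^sub>0\<close> to \<open>\<sigma>\<close> bijectively onto
  those taking \<open>\<tau>\<^sub>0\<close> to \<open>q\<sigma>\<close>, whence \<open>\<Phi>(q v) = q \<Phi>(v)\<close> (lemma \<open>lin_ext_transporter_mean_act\<close>).
  Moreover \<open>\<Phi>(|\<tau>\<^sub>0\<rangle>)\<close> is the mean of the stabilizer of \<open>\<tau>\<^sub>0\<close>, which is the Young subgroup, and
  \<open>e\<close> absorbs its elements from the right; so \<open>A \<Phi>(|\<tau>\<^sub>0\<rangle>) = A\<close>. Altogether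
  \<open>A = A \<Phi>(|\<tau>\<^sub>0\<rangle>) = \<Phi>(w) = \<Phi>(b u) = b \<Phi>(u) \<in> R\<close>.
\<close>

section \<open>Linearity of the action and of the product\<close>

lemma act_ket_ket [simp]: "act (ket p) (ket \<sigma>) = ket (\<sigma> \<circ> Hilbert_Choice.inv p)"
  by (simp add: act_def)

lemma act_linear:
  "act (a + b) u = act a u + act b u"
  "act a (u + v) = act a u + act a v"
  "act (k *\<^sub>c a) u = k *\<^sub>c act a u"
  "act a (k *\<^sub>c u) = k *\<^sub>c act a u"
  "act 0 u = 0"
  "act a 0 = 0"
  by (simp_all add: act_def lin_ext_add lin_ext_cscale lin_ext_fun_add lin_ext_fun_cscale)

lemma group_ring_mult_sum:
  "(\<Sum>i\<in>I. f i) \<otimes>\<^bsub>group_ring G\<^esub> b = (\<Sum>i\<in>I. f i \<otimes>\<^bsub>group_ring G\<^esub> b)"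
  "a \<otimes>\<^bsub>group_ring G\<^esub> (\<Sum>i\<in>I. f i) = (\<Sum>i\<in>I. a \<otimes>\<^bsub>group_ring G\<^esub> f i)"
  by (induction I rule: infinite_finite_induct) (simp_all add: group_ring_mult_linear)

lemma lin_ext_in_span:
  assumes "\<And>x. f x \<in> cvs.span B"
  shows "lin_ext f a \<in> cvs.span B"
  by (simp add: lin_ext_def cvs.span_sum cvs.span_scale assms)

lemma ket_in_span: "x \<in> X \<Longrightarrow> ket x \<in> cvs.span (ket ` X)"
  by (simp add: cvs.span_base)

lemma carrier_sym_group [simp]: "carrier (sym_group N) = {p. p permutes {1..N}}"
  by (simp add: sym_group_def)

lemma mult_sym_group [simp]: "p \<otimes>\<^bsub>sym_group N\<^esub> q = p \<circ> q"
  by (simp add: sym_group_def)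

lemma ring_CS: "ring (CS N)"
  by (intro ring_group_ring group.is_monoid sym_group_is_group)

section \<open>An equivariant map from spin vectors to the group ring\<close>

definition transporter :: "nat \<Rightarrow> (nat \<Rightarrow> 'a) \<Rightarrow> (nat \<Rightarrow> 'a) \<Rightarrow> (nat \<Rightarrow> nat) set"
  where "transporter N \<tau> \<sigma> = {p. p permutes {1..N} \<and> \<tau> \<circ> Hilbert_Choice.inv p = \<sigma>}"

text \<open>The scalar is chosen so that \<open>transporter_mean N \<tau> \<tau>\<close> is the idempotent of the stabilizer
  of \<open>\<tau>\<close>. The normalization must not depend on \<open>\<sigma>\<close>, so that the family remains equivariant.\<close>

definition transporter_mean :: "nat \<Rightarrow> (nat \<Rightarrow> 'a) \<Rightarrow> (nat \<Rightarrow> 'a) \<Rightarrow> ((nat \<Rightarrow> nat) \<Rightarrow>\<^sub>0 complex)"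
  where "transporter_mean N \<tau> \<sigma> =
    (1 / of_nat (card (transporter N \<tau> \<tau>))) *\<^sub>c (\<Sum>p\<in>transporter N \<tau> \<sigma>. ket p)"

lemma finite_transporter: "finite (transporter N \<tau> \<sigma>)"
  by (rule finite_subset[OF _ finite_permutations[of "{1..N}"]]) (auto simp: transporter_def)

lemma transporter_mean_in_carrier: "transporter_mean N \<tau> \<sigma> \<in> carrier (CS N)"
  by (auto simp: transporter_mean_def transporter_def
      intro!: cvs.span_scale cvs.span_sum ket_in_span)

lemma transporter_translate:
  assumes "q permutes {1..N}" "p \<in> transporter N \<tau> \<sigma>"
  shows "q \<circ> p \<in> transporter N \<tau> (\<sigma> \<circ> Hilbert_Choice.inv q)"
  using assms
  by (auto simp: transporter_def permutes_compose o_inv_distrib permutes_bij o_assoc)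

text \<open>Left translation by \<open>q\<close> is a bijection from the permutations taking \<open>\<tau>\<close> to \<open>\<sigma>\<close> onto those
  taking \<open>\<tau>\<close> to \<open>q\<sigma>\<close>; its inverse is translation by \<open>inv q\<close>.\<close>

lemma ket_mult_transporter_mean:
  assumes q: "q permutes {1..N}"
  shows "ket q \<otimes>\<^bsub>CS N\<^esub> transporter_mean N \<tau> \<sigma>
    = transporter_mean N \<tau> (\<sigma> \<circ> Hilbert_Choice.inv q)"
proof -
  let ?q' = "Hilbert_Choice.inv q"
  have inverse: "q \<circ> ?q' = id" "?q' \<circ> q = id"
    using q by (simp_all add: permutes_inv_o)
  have pull_back: "?q' \<circ> p \<in> transporter N \<tau> \<sigma>" if "p \<in> transporter N \<tau> (\<sigma> \<circ> ?q')" for p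
  proof -
    have "?q' \<circ> p \<in> transporter N \<tau> (\<sigma> \<circ> ?q' \<circ> Hilbert_Choice.inv ?q')"
      by (rule transporter_translate[OF permutes_inv[OF q] that])
    also have "\<sigma> \<circ> ?q' \<circ> Hilbert_Choice.inv ?q' = \<sigma>"
      using q inverse by (simp add: permutes_inv_inv comp_assoc)
    finally show ?thesis .
  qed
  have "(\<Sum>p\<in>transporter N \<tau> \<sigma>. ket (q \<circ> p)) = (\<Sum>p\<in>transporter N \<tau> (\<sigma> \<circ> ?q'). ket p)"
    by (rule sum.reindex_bij_witness[where j = "\<lambda>p. q \<circ> p" and i = "\<lambda>p. ?q' \<circ> p"])
      (use inverse pull_back transporter_translate[OF q] in \<open>simp_all add: o_assoc\<close>)
  then show ?thesis
    by (simp add: transporter_mean_def group_ring_mult_linear group_ring_mult_sum)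
qed

text \<open>The linear map \<open>\<Phi>\<close> is equivariant because it is so on basis elements. This is what lets
  \<open>\<Phi>\<close> carry an equation \<open>w = b u\<close> between vectors over to the group ring.\<close>

lemma lin_ext_transporter_mean_act:
  assumes "b \<in> carrier (CS N)" "u \<in> cvs.span (ket ` X)"
  shows "lin_ext (transporter_mean N \<tau>) (act b u)
    = b \<otimes>\<^bsub>CS N\<^esub> lin_ext (transporter_mean N \<tau>) u"
proof -
  have ket: "lin_ext (transporter_mean N \<tau>) (act (ket q) u)
      = ket q \<otimes>\<^bsub>CS N\<^esub> lin_ext (transporter_mean N \<tau>) u" if "q permutes {1..N}" for q
    using assms(2) by (induction rule: ket_span_induct)
      (simp_all add: act_linear lin_ext_add lin_ext_cscale group_ring_mult_linear
        ket_mult_transporter_mean[OF that])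
  have "b \<in> cvs.span (ket ` {p. p permutes {1..N}})"
    using assms(1) by simp
  then show ?thesis
    by (induction rule: ket_span_induct)
      (simp_all add: act_linear lin_ext_add lin_ext_cscale group_ring_mult_linear ket)
qed

section \<open>The Young subgroup as a stabilizer\<close>

text \<open>A permutation fixes \<open>\<tau>\<^sub>0\<close> exactly when it preserves the two level sets of \<open>\<tau>\<^sub>0\<close>, which are
  the two blocks of the Young subgroup.\<close>

lemma transporter_tau0:
  "transporter (r1 + r2) (tau0 r1 r2) (tau0 r1 r2) = young_subgroup r1 r2"
proof -
  let ?N = "r1 + r2" and ?\<tau> = "tau0 r1 r2"
  have "?\<tau> \<circ> Hilbert_Choice.inv p = ?\<tau> \<longleftrightarrow>
      p ` {1..r1} = {1..r1} \<and> p ` {r1 + 1..?N} = {r1 + 1..?N}"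
    if p: "p permutes {1..?N}" for p
  proof -
    have in_N: "p i \<in> {1..?N} \<longleftrightarrow> i \<in> {1..?N}" for i
      using p by (rule permutes_in_image)
    have "?\<tau> \<circ> Hilbert_Choice.inv p = ?\<tau> \<longleftrightarrow> ?\<tau> = ?\<tau> \<circ> p"
    proof
      assume "?\<tau> \<circ> Hilbert_Choice.inv p = ?\<tau>"
      then have "?\<tau> \<circ> Hilbert_Choice.inv p \<circ> p = ?\<tau> \<circ> p"
        by simp
      then show "?\<tau> = ?\<tau> \<circ> p"
        using p by (simp add: comp_assoc permutes_inv_o)
    next
      assume "?\<tau> = ?\<tau> \<circ> p"
      then have "?\<tau> \<circ> Hilbert_Choice.inv p = ?\<tau> \<circ> p \<circ> Hilbert_Choice.inv p"
        by simp
      then show "?\<tau> \<circ> Hilbert_Choice.inv p = ?\<tau>"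
        using p by (simp add: comp_assoc permutes_inv_o)
    qed
    also have "\<dots> \<longleftrightarrow> (\<forall>i\<in>{1..?N}. p i \<le> r1 \<longleftrightarrow> i \<le> r1)"
    proof -
      have "?\<tau> i = ?\<tau> (p i) \<longleftrightarrow> (i \<in> {1..?N} \<longrightarrow> (p i \<le> r1 \<longleftrightarrow> i \<le> r1))" for i
        using in_N[of i] by (auto simp: tau0_def restrict_def)
      then show ?thesis
        by (auto simp: fun_eq_iff)
    qed
    also have "\<dots> \<longleftrightarrow> p ` {1..r1} = {1..r1} \<and> p ` {r1 + 1..?N} = {r1 + 1..?N}"
    proof
      assume *: "\<forall>i\<in>{1..?N}. p i \<le> r1 \<longleftrightarrow> i \<le> r1"
      have "p i \<in> {1..r1}" if "i \<in> {1..r1}" for i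
        using * in_N[of i] that by auto
      moreover have "p i \<in> {r1 + 1..?N}" if "i \<in> {r1 + 1..?N}" for i
        using *[rule_format, of i] in_N[of i] that by auto
      ultimately have "p ` {1..r1} \<subseteq> {1..r1}" "p ` {r1 + 1..?N} \<subseteq> {r1 + 1..?N}"
        by blast+
      then show "p ` {1..r1} = {1..r1} \<and> p ` {r1 + 1..?N} = {r1 + 1..?N}"
        using permutes_inj_on[OF p] by (simp add: endo_inj_surj)
    next
      assume *: "p ` {1..r1} = {1..r1} \<and> p ` {r1 + 1..?N} = {r1 + 1..?N}"
      show "\<forall>i\<in>{1..?N}. p i \<le> r1 \<longleftrightarrow> i \<le> r1"
      proof
        fix i assume i: "i \<in> {1..?N}"
        show "p i \<le> r1 \<longleftrightarrow> i \<le> r1"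
        proof (cases "i \<le> r1")
          case True
          then have "p i \<in> p ` {1..r1}" using i by simp
          with * True show ?thesis by simp
        next
          case False
          then have "p i \<in> p ` {r1 + 1..?N}" using i by simp
          with * False show ?thesis by simp
        qed
      qed
    qed
    finally show ?thesis .
  qed
  then show ?thesis
    unfolding transporter_def young_subgroup_def carrier_sym_group by blast
qed

lemma id_in_young_subgroup: "id \<in> young_subgroup r1 r2"
  by (simp add: young_subgroup_def)

lemma young_subgroup_mult_bij:
  assumes "t \<in> young_subgroup r1 r2"
  shows "bij_betw (\<lambda>s. s \<circ> t) (young_subgroup r1 r2) (young_subgroup r1 r2)"
proof (rule bij_betw_imageI)
  let ?Y = "young_subgroup r1 r2"
  have t: "t permutes {1..r1 + r2}"
    using assms by (simp add: young_subgroup_def)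
  show inj: "inj_on (\<lambda>s. s \<circ> t) ?Y"
    by (rule inj_onI) (metis t comp_assoc comp_id permutes_inv_o(1))
  have fin: "finite ?Y"
    by (simp add: finite_transporter flip: transporter_tau0)
  have "s \<circ> t \<in> ?Y" if "s \<in> ?Y" for s
    using assms that unfolding young_subgroup_def carrier_sym_group mem_Collect_eq
    by (metis image_comp permutes_compose)
  then have "(\<lambda>s. s \<circ> t) ` ?Y \<subseteq> ?Y"
    by blast
  then show "(\<lambda>s. s \<circ> t) ` ?Y = ?Y"
    by (rule endo_inj_surj[OF fin _ inj])
qed

lemma young_symmetrizer_absorbs:
  assumes "t \<in> young_subgroup r1 r2"
  shows "young_symmetrizer r1 r2 \<otimes>\<^bsub>CS (r1 + r2)\<^esub> ket t = young_symmetrizer r1 r2"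
  using sum.reindex_bij_betw[OF young_subgroup_mult_bij[OF assms], of ket]
  by (simp add: young_symmetrizer_def group_ring_mult_linear group_ring_mult_sum)

lemma young_symmetrizer_in_carrier: "young_symmetrizer r1 r2 \<in> carrier (CS (r1 + r2))"
  by (auto simp: young_symmetrizer_def young_subgroup_def
      intro!: cvs.span_scale cvs.span_sum ket_in_span)

text \<open>Both factors are multiples of the sum over the Young subgroup. The coefficients of the
  right one add up to \<open>1\<close>, and the left one absorbs each of its permutations, so the product is the
  left factor.\<close>

lemma young_symmetrizer_mult_transporter_mean:
  "young_symmetrizer r1 r2 \<otimes>\<^bsub>CS (r1 + r2)\<^esub>
      transporter_mean (r1 + r2) (tau0 r1 r2) (tau0 r1 r2) = young_symmetrizer r1 r2"
proof -
  let ?Y = "young_subgroup r1 r2" and ?e = "young_symmetrizer r1 r2"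
  have "finite ?Y"
    by (simp add: finite_transporter flip: transporter_tau0)
  then have card: "card ?Y \<noteq> 0"
    using id_in_young_subgroup by auto
  have sum: "(\<Sum>t\<in>?Y. ?e) = of_nat (card ?Y) *\<^sub>c ?e"
    by (rule poly_mapping_eqI) (simp add: lookup_sum)
  show ?thesis
    using card
    by (simp add: transporter_mean_def transporter_tau0 group_ring_mult_linear
        group_ring_mult_sum young_symmetrizer_absorbs sum)
qed

section \<open>Minimality of the right ideal\<close>

lemma lex_least_reps_subset: "lex_least_reps r1 r2 \<subseteq> carrier (sym_group (r1 + r2))"
  by (auto simp: lex_least_reps_def LCOSETS_def l_coset_def young_subgroup_def
      permutes_compose)

lemma tau0_in_spin_configs: "tau0 r1 r2 \<in> spin_configs (r1 + r2)"
  by (auto simp: tau0_def spin_configs_def)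

theorem theorem2p10:
  fixes N r1 r2 :: nat
    and w a_w :: "(nat \<Rightarrow> nat) \<Rightarrow>\<^sub>0 complex"
    and R_w :: "((nat \<Rightarrow> nat) \<Rightarrow>\<^sub>0 complex) set"
  assumes "N = r1 + r2"
    and "w \<in> weight_space r1 r2"
    and "a_w \<in> cvs.span (ket ` lex_least_reps r1 r2)"
    and "w = act (a_w \<otimes>\<^bsub>CS N\<^esub> young_symmetrizer r1 r2) (ket (tau0 r1 r2))"
    and "R_w = (a_w \<otimes>\<^bsub>CS N\<^esub> young_symmetrizer r1 r2) <#\<^bsub>CS N\<^esub> carrier (CS N)"
  shows "w \<in> symmetry_class N R_w \<and>
    (\<forall>R. right_ideal R (CS N) \<longrightarrow> w \<in> symmetry_class N R \<longrightarrow> R_w \<subseteq> R)"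
proof -
  interpret ring "CS N" by (rule ring_CS)
  define e where "e = young_symmetrizer r1 r2"
  define \<tau> where "\<tau> = tau0 r1 r2"
  define A where "A = a_w \<otimes>\<^bsub>CS N\<^esub> e"
  define \<Phi> where "\<Phi> = lin_ext (transporter_mean N \<tau>)"
  have a_w: "a_w \<in> carrier (CS N)"
    using assms(3) cvs.span_mono[OF image_mono[OF lex_least_reps_subset]] assms(1) by auto
  have e: "e \<in> carrier (CS N)"
    unfolding e_def assms(1) by (rule young_symmetrizer_in_carrier)
  have A: "A \<in> carrier (CS N)"
    unfolding A_def using a_w e by (rule m_closed)
  have \<tau>: "ket \<tau> \<in> spin_space N"
    unfolding \<tau>_def spin_space_def assms(1) by (intro ket_in_span tau0_in_spin_configs)
  have w: "w = act A (ket \<tau>)"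
    using assms(4) by (simp add: A_def e_def \<tau>_def)
  have R_w: "R_w = A <#\<^bsub>CS N\<^esub> carrier (CS N)"
    using assms(5) by (simp add: A_def e_def)
  have \<Phi>_carrier: "\<Phi> v \<in> carrier (CS N)" for v
    unfolding \<Phi>_def group_ring_simps
    by (rule lin_ext_in_span) (use transporter_mean_in_carrier in simp)
  have \<Phi>_act: "\<Phi> (act b u) = b \<otimes>\<^bsub>CS N\<^esub> \<Phi> u"
    if "b \<in> carrier (CS N)" "u \<in> spin_space N" for b u
    unfolding \<Phi>_def using that unfolding spin_space_def by (rule lin_ext_transporter_mean_act)
  have "e \<otimes>\<^bsub>CS N\<^esub> \<Phi> (ket \<tau>) = e"
    by (simp add: \<Phi>_def \<tau>_def e_def assms(1) young_symmetrizer_mult_transporter_mean)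
  then have "A \<otimes>\<^bsub>CS N\<^esub> \<Phi> (ket \<tau>) = A"
    unfolding A_def using m_assoc[OF a_w e \<Phi>_carrier] by simp
  then have \<Phi>_w: "\<Phi> w = A"
    by (simp only: w \<Phi>_act[OF A \<tau>])
  have "A \<in> R_w"
    unfolding R_w l_coset_def using r_one[OF A] one_closed by force
  then have "w \<in> symmetry_class N R_w"
    using w \<tau> by (auto simp: symmetry_class_def)
  moreover have "R_w \<subseteq> R" if R: "right_ideal R (CS N)" and w_in: "w \<in> symmetry_class N R" for R
  proof -
    interpret R: right_ideal R "CS N" by (rule R)
    obtain b u where b: "b \<in> R" and u: "u \<in> spin_space N" and w_bu: "w = act b u"
      using w_in by (auto simp: symmetry_class_def)
    have "b \<in> carrier (CS N)"
      using b by (rule R.a_Hcarr)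
    then have "A = b \<otimes>\<^bsub>CS N\<^esub> \<Phi> u"
      using \<Phi>_act u w_bu \<Phi>_w by metis
    also have "\<dots> \<in> R"
      using b \<Phi>_carrier by (rule R.I_r_closed)
    finally have "A \<in> R" .
    then show ?thesis
      unfolding R_w l_coset_def using R.I_r_closed by blast
  qed
  ultimately show ?thesis by blast
qed

end
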